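(* Let $n\geq 0$. For $\mathcal{R}\in\mathrm{Tr}([n])$, let $\psi(\mathcal{R})$ be the partition of $[n]=\{0,1,\dots,n\}$ associated to the equivalence relation generated by $M(\mathcal{R})$. Then (1) $\psi(\mathcal{R})$ is a noncrossing partition, and (2) the map $\psi\colon\mathrm{Tr}([n])\to\mathrm{NC}_{n+1}$ is a bijection with inverse $\chi(\pi)=\langle J(\pi)\rangle$.
   Context: $[n]$ is the poset $\{0<1<\dots<n\}$. A transfer system on $[n]$ is a partial order $\mathcal{R}$ on the set $\{0,\dots,n\}$ that refines $\leq$ (i.e. $i\,\mathcal{R}\,j$ implies $i\leq j$) and such that if $i\,\mathcal{R}\,j$ and $k\leq j$ then $\min(i,k)\,\mathcal{R}\,k$. $\mathrm{Tr}([n])$ denotes the set of all transfer systems on $[n]$. One writes $i\to j\in\mathcal{R}$ for $i\,\mathcal{R}\,j$ and calls $i\to j$ an edge, nontrivial if $i\neq j$. A partition of $\{0,\dots,n\}$ is noncrossing if whenever $0\leq a<b<c<d\leq n$ are such that $a,c$ are in the same class and $b,d$ are in the same class, then $a,b,c,d$ are all in the same class. $\mathrm{NC}_{n+1}$ is the set of noncrossing partitions of $\{0,\dots,n\}$. For $\mathcal{R}\in\mathrm{Tr}([n])$, an edge $i\to j\in\mathcal{R}$ is maximal if $i\neq j$ and there is no $k>j$ with $i\to k\in\mathcal{R}$; $M(\mathcal{R})$ is the set of maximal edges in $\mathcal{R}$. For a noncrossing partition $\pi$ of $\{0,\dots,n\}$, $J(\pi)$ is the set of nontrivial edges $i\to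 m$ where $i$ is an element of a block of $\pi$ and $m\neq i$ is the largest element of that block. For a binary relation $\mathcal{F}$ on $[n]$ refining $\leq$, $\langle\mathcal{F}\rangle$ denotes the minimal transfer system on $[n]$ containing $\mathcal{F}$. *)

theory Defs
  imports Main "HOL-Library.Disjoint_Sets"
begin

text \<open>Relations on the poset \<open>[n] = {0 < 1 < ... < n}\<close> are sets of pairs;
  an edge \<open>i \<rightarrow> j\<close> of \<open>R\<close> is a pair \<open>(i, j) \<in> R\<close>.\<close>

definition transfer_system :: "nat \<Rightarrow> nat rel \<Rightarrow> bool" where
  "transfer_system n R \<longleftrightarrow>
     partial_order_on {0..n} R \<and>
     (\<forall>i j. (i, j) \<in> R \<longrightarrow> i \<le> j) \<and>
     (\<forall>i j k. (i, j) \<in> R \<longrightarrow> k \<le> j \<longrightarrow> (min i k, k) \<in> R)"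

definition Tr :: "nat \<Rightarrow> nat rel set" where
  "Tr n = {R. transfer_system n R}"

definition noncrossing :: "nat \<Rightarrow> nat set set \<Rightarrow> bool" where
  "noncrossing n P \<longleftrightarrow>
     (\<forall>a b c d. a < b \<and> b < c \<and> c < d \<and> d \<le> n \<and>
        (\<exists>B\<in>P. a \<in> B \<and> c \<in> B) \<and> (\<exists>B\<in>P. b \<in> B \<and> d \<in> B) \<longrightarrow>
        (\<exists>B\<in>P. a \<in> B \<and> b \<in> B \<and> c \<in> B \<and> d \<in> B))"

text \<open>The index is the top element of \<open>[n]\<close>, not the number of elements:
  \<open>NC n\<close> is the set usually written \<open>NC\<^sub>n\<^sub>+\<^sub>1\<close>.\<close>

definition NC :: "nat \<Rightarrow> nat set set set" where
  "NC n = {P. partition_on {0..n} P \<and> noncrossing n P}"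

definition maximal_edges :: "nat rel \<Rightarrow> nat rel" where
  "maximal_edges R = {(i, j). (i, j) \<in> R \<and> i \<noteq> j \<and> \<not> (\<exists>k>j. (i, k) \<in> R)}"

text \<open>The library's \<open>equivclp\<close> is the generated equivalence relation on the whole
  type \<open>nat\<close>, so it is cut down to \<open>{0..n}\<close>.\<close>

definition psi :: "nat \<Rightarrow> nat rel \<Rightarrow> nat set set" where
  "psi n R = {0..n} //
     {(i, j) \<in> {0..n} \<times> {0..n}. equivclp (\<lambda>a b. (a, b) \<in> maximal_edges R) i j}"

definition J :: "nat set set \<Rightarrow> nat rel" where
  "J P = {(i, m). \<exists>B\<in>P. i \<in> B \<and> m = Max B \<and> m \<noteq> i}"

text \<open>The lemma below shows that this intersection is the least transfer system
  containing \<open>F\<close>, whenever \<open>F\<close> is a relation on \<open>[n]\<close> refining \<open>\<le>\<close>.\<close>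

definition generated_transfer_system :: "nat \<Rightarrow> nat rel \<Rightarrow> nat rel" where
  "generated_transfer_system n F = \<Inter> {R. transfer_system n R \<and> F \<subseteq> R}"

lemma generated_transfer_system_least:
  assumes "F \<subseteq> {0..n} \<times> {0..n}" and "\<And>i j. (i, j) \<in> F \<Longrightarrow> i \<le> j"
  shows "transfer_system n (generated_transfer_system n F)"
    and "F \<subseteq> generated_transfer_system n F"
    and "\<And>R. transfer_system n R \<Longrightarrow> F \<subseteq> R \<Longrightarrow> generated_transfer_system n F \<subseteq> R"
proof -
  let ?G = "generated_transfer_system n F"
  let ?L = "{(i, j). i \<le> j \<and> j \<le> n}"
  have ts: "transfer_system n R \<longleftrightarrow> R \<subseteq> ?L \<and> (\<forall>i\<le>n. (i, i) \<in> R) \<and> trans R \<and>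
      (\<forall>i j k. (i, j) \<in> R \<longrightarrow> k \<le> j \<longrightarrow> (min i k, k) \<in> R)" for R
  proof -
    have sub: "R \<subseteq> {0..n} \<times> {0..n} \<and> (\<forall>i j. (i, j) \<in> R \<longrightarrow> i \<le> j) \<longleftrightarrow> R \<subseteq> ?L"
      by fastforce
    have anti: "antisym R" if "R \<subseteq> ?L"
    proof (rule antisymI)
      fix x y assume "(x, y) \<in> R" "(y, x) \<in> R"
      then have "(x, y) \<in> ?L" "(y, x) \<in> ?L" using that by blast+
      then show "x = y" by simp
    qed
    have refl: "refl_on {0..n} R \<longleftrightarrow> (\<forall>i\<le>n. (i, i) \<in> R)"
      by (auto simp: refl_on_def)
    show ?thesis
      unfolding transfer_system_def partial_order_on_def preorder_on_def refl sub[symmetric]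
      using anti[folded sub] by argo
  qed
  have "trans ?L"
    by (rule transI) auto
  then have L: "transfer_system n ?L"
    unfolding ts by auto
  have FL: "F \<subseteq> ?L"
  proof
    fix x assume x: "x \<in> F"
    obtain i j where ij: "x = (i, j)" by (cases x)
    have "x \<in> {0..n} \<times> {0..n}" using assms(1) x by (rule subsetD)
    moreover have "i \<le> j" using assms(2) x ij by simp
    ultimately show "x \<in> ?L" using ij by simp
  qed
  have mem: "x \<in> ?G \<longleftrightarrow> (\<forall>R. transfer_system n R \<longrightarrow> F \<subseteq> R \<longrightarrow> x \<in> R)" for x
    unfolding generated_transfer_system_def by blast
  have "?G \<subseteq> ?L"
    unfolding generated_transfer_system_def using L FL by (intro Inter_lower CollectI conjI)
  moreover have "\<forall>i\<le>n. (i, i) \<in> ?G"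
    unfolding mem by (simp add: ts)
  moreover have "trans ?G"
  proof (rule transI)
    fix x y z assume xy: "(x, y) \<in> ?G" and yz: "(y, z) \<in> ?G"
    have "(x, z) \<in> R" if R: "transfer_system n R" "F \<subseteq> R" for R
    proof (rule transD)
      show "trans R" using R(1) unfolding ts by (elim conjE)
      show "(x, y) \<in> R" "(y, z) \<in> R" using xy yz R mem by simp_all
    qed
    then show "(x, z) \<in> ?G"
      by (simp add: mem)
  qed
  moreover have "(min i k, k) \<in> ?G" if ij: "(i, j) \<in> ?G" and k: "k \<le> j" for i j k
  proof -
    have "(min i k, k) \<in> R" if R: "transfer_system n R" "F \<subseteq> R" for R
    proof -
      have "(i, j) \<in> R" using ij R mem by simp
      then show ?thesis using R(1) k unfolding transfer_system_def by (elim conjE) simp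
    qed
    then show ?thesis by (simp add: mem)
  qed
  ultimately show "transfer_system n ?G"
    unfolding ts by (intro conjI allI impI) simp_all
  show "F \<subseteq> ?G" and "\<And>R. transfer_system n R \<Longrightarrow> F \<subseteq> R \<Longrightarrow> ?G \<subseteq> R"
    unfolding generated_transfer_system_def by blast+
qed

definition chi :: "nat \<Rightarrow> nat set set \<Rightarrow> nat rel" where
  "chi n P = generated_transfer_system n (J P)"

end

theory Submission
  imports Defs
begin

text \<open>By restriction, a transfer system \<open>R\<close> on \<open>[n]\<close> is determined by the function \<open>f\<close> sending
  \<open>i\<close> to the largest \<open>j\<close> with \<open>i \<rightarrow> j \<in> R\<close>: one has \<open>i \<rightarrow> j \<in> R\<close> iff \<open>i \<le> j \<le> f i\<close>. The functions
  that arise are those with \<open>i \<le> f i \<le> n\<close> such that \<open>i \<le> j \<le> f i\<close> implies \<open>f j \<le> f i\<close>; in particular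
  they are idempotent. The maximal edges of \<open>R\<close> are the edges \<open>i \<rightarrow> f i\<close> with \<open>i \<noteq> f i\<close>, so \<open>\<psi>(R)\<close> is
  the partition into fibres of \<open>f\<close>, and \<open>f i\<close> is the maximum of the fibre through \<open>i\<close>. The
  noncrossing condition on a partition is exactly the condition above for the function sending
  each element to the maximum of its block.\<close>

definition nested :: "nat \<Rightarrow> (nat \<Rightarrow> nat) \<Rightarrow> bool" where
  "nested n f \<longleftrightarrow> (\<forall>i\<le>n. i \<le> f i \<and> f i \<le> n \<and> (\<forall>j. i \<le> j \<longrightarrow> j \<le> f i \<longrightarrow> f j \<le> f i))"

definition below :: "nat \<Rightarrow> (nat \<Rightarrow> nat) \<Rightarrow> nat rel" where
  "below n f = {(i, j). i \<le> n \<and> i \<le> j \<and> j \<le> f i}"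

text \<open>The loops \<open>i = f i\<close> are dropped so that this relation equals both
  \<open>maximal_edges (below n f)\<close> and \<open>J (fibres n f)\<close>, which links
  \<open>psi\<close> with \<open>chi\<close>.\<close>

definition proper_graph :: "nat \<Rightarrow> (nat \<Rightarrow> nat) \<Rightarrow> nat rel" where
  "proper_graph n f = {(i, j). i \<le> n \<and> j = f i \<and> i \<noteq> j}"

definition fibres :: "nat \<Rightarrow> (nat \<Rightarrow> nat) \<Rightarrow> nat set set" where
  "fibres n f = (\<lambda>i. {j \<in> {0..n}. f j = f i}) ` {0..n}"

lemma nestedD:
  assumes "nested n f" "i \<le> n"
  shows "i \<le> f i" "f i \<le> n" "\<And>j. i \<le> j \<Longrightarrow> j \<le> f i \<Longrightarrow> f j \<le> f i"
  using assms by (auto simp: nested_def)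

lemma nested_idem:
  assumes "nested n f" "i \<le> n"
  shows "f (f i) = f i"
  by (meson assms le_antisym nestedD order_refl)

section \<open>Transfer systems and nested functions\<close>

lemma transfer_systemD:
  assumes "transfer_system n R"
  shows "(i, j) \<in> R \<Longrightarrow> i \<le> j" "(i, j) \<in> R \<Longrightarrow> j \<le> n"
    and "i \<le> n \<Longrightarrow> (i, i) \<in> R"
    and "(i, j) \<in> R \<Longrightarrow> (j, k) \<in> R \<Longrightarrow> (i, k) \<in> R"
    and "(i, j) \<in> R \<Longrightarrow> i \<le> k \<Longrightarrow> k \<le> j \<Longrightarrow> (i, k) \<in> R"
proof -
  have po: "partial_order_on {0..n} R"
    and le: "\<And>i j. (i, j) \<in> R \<Longrightarrow> i \<le> j"
    and restr: "\<And>i j k. (i, j) \<in> R \<Longrightarrow> k \<le> j \<Longrightarrow> (min i k, k) \<in> R"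
    using assms by (auto simp: transfer_system_def)
  have refl: "refl_on {0..n} R" and sub: "R \<subseteq> {0..n} \<times> {0..n}" and trans: "trans R"
    using po by (auto simp: partial_order_on_def preorder_on_def)
  show "(i, j) \<in> R \<Longrightarrow> i \<le> j" by (fact le)
  show "(i, j) \<in> R \<Longrightarrow> j \<le> n" using sub by auto
  show "i \<le> n \<Longrightarrow> (i, i) \<in> R" using refl by (simp add: refl_on_def)
  show "(i, j) \<in> R \<Longrightarrow> (j, k) \<in> R \<Longrightarrow> (i, k) \<in> R" using trans by (rule transD)
  show "(i, j) \<in> R \<Longrightarrow> i \<le> k \<Longrightarrow> k \<le> j \<Longrightarrow> (i, k) \<in> R" using restr[of i j k] by (simp add: min_def)
qed

text \<open>Nesting gives transitivity. Restriction to \<open>k\<close> either shortens an interval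
  starting at \<open>i\<close>, or, when \<open>k < i\<close>, yields the loop at
  \<open>k\<close>.\<close>

lemma transfer_system_below:
  assumes "nested n f"
  shows "transfer_system n (below n f)"
proof -
  note D = nestedD[OF assms]
  have "trans (below n f)"
  proof (rule transI)
    fix i j k assume "(i, j) \<in> below n f" "(j, k) \<in> below n f"
    then show "(i, k) \<in> below n f"
      using D(3)[of i j] by (simp add: below_def)
  qed
  moreover have "below n f \<subseteq> {0..n} \<times> {0..n}"
    using D(2) by (fastforce simp: below_def)
  moreover have "refl_on {0..n} (below n f)"
    using D(1) by (auto simp: below_def refl_on_def)
  moreover have "antisym (below n f)"
    by (rule antisymI) (auto simp: below_def)
  moreover have "(min i k, k) \<in> below n f" if "(i, j) \<in> below n f" "k \<le> j" for i j k
    using that D(1)[of k] by (auto simp: below_def min_def)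
  ultimately show ?thesis
    by (auto simp: transfer_system_def partial_order_on_def preorder_on_def below_def)
qed

lemma transfer_system_imp_below:
  assumes "transfer_system n R"
  obtains f where "nested n f" "R = below n f"
proof
  note D = transfer_systemD[OF assms]
  \<comment> \<open>For \<open>i > n\<close> the image is empty and \<open>f i\<close> is
    unspecified, hence the conjunct \<open>i \<le> n\<close> in \<open>iff\<close>.\<close>
  define f where "f = (\<lambda>i. Max (R `` {i}))"
  have fin: "finite (R `` {i})" for i
    by (rule finite_subset[of _ "{..n}"]) (auto dest: D(2))
  have fR: "(i, f i) \<in> R" if "i \<le> n" for i
    using Max_in[OF fin[of i]] D(3)[OF that] by (auto simp: f_def)
  have le_f: "j \<le> f i" if "(i, j) \<in> R" for i j
    using Max_ge[OF fin[of i]] that by (simp add: f_def)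
  have iff: "(i, j) \<in> R \<longleftrightarrow> i \<le> n \<and> i \<le> j \<and> j \<le> f i" for i j
    by (meson D(1,2,5) fR le_f order_trans)
  then show "R = below n f"
    by (auto simp: below_def)
  show "nested n f"
    unfolding nested_def
  proof (intro allI impI conjI)
    fix i assume i: "i \<le> n"
    show "i \<le> f i" "f i \<le> n" using D(1,2)[OF fR[OF i]] .
    fix j assume "i \<le> j" "j \<le> f i"
    then have "(i, j) \<in> R" and "j \<le> n" using i iff \<open>f i \<le> n\<close> by auto
    \<comment> \<open>The edges from \<open>i\<close> to \<open>j\<close> and from \<open>j\<close>
      to \<open>f j\<close> compose to an edge from \<open>i\<close> to \<open>f j\<close>.\<close>
    then show "f j \<le> f i" using D(4) fR le_f by blast
  qed
qed

section \<open>Maximal edges and fibres\<close>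

lemma maximal_edges_below:
  assumes "nested n f"
  shows "maximal_edges (below n f) = proper_graph n f"
proof -
  have "j = f i" if "i \<le> n" "j \<le> f i" "i \<le> j" "\<forall>k>j. i \<le> k \<longrightarrow> \<not> k \<le> f i" for i j
    using that nestedD(1)[OF assms that(1)] by (meson le_neq_implies_less order_refl)
  then show ?thesis
    using nestedD(1)[OF assms] by (auto simp: maximal_edges_def below_def proper_graph_def)
qed

text \<open>By idempotence \<open>f\<close> is constant along each edge; conversely \<open>i\<close>
  and \<open>j\<close> are both linked to their common value.\<close>

lemma equivclp_proper_graph:
  assumes "nested n f" "i \<le> n" "j \<le> n"
  shows "equivclp (\<lambda>a b. (a, b) \<in> proper_graph n f) i j \<longleftrightarrow> f i = f j"
proof
  let ?E = "equivclp (\<lambda>a b. (a, b) \<in> proper_graph n f)"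
  assume "?E i j"
  then show "f i = f j"
    by (induction rule: equivclp_induct) (auto simp: proper_graph_def nested_idem[OF assms(1)])
next
  let ?E = "equivclp (\<lambda>a b. (a, b) \<in> proper_graph n f)"
  have E: "?E k (f k)" if "k \<le> n" for k
    using that by (cases "k = f k") (auto simp: proper_graph_def)
  assume "f i = f j"
  then have "?E i (f j)" "?E (f j) j"
    using E[OF assms(2)] E[OF assms(3)] by (auto intro: equivclp_sym)
  then show "?E i j"
    by (rule equivclp_trans)
qed

lemma psi_below:
  assumes "nested n f"
  shows "psi n (below n f) = fibres n f"
proof -
  have "{(i, j) \<in> {0..n} \<times> {0..n}. equivclp (\<lambda>a b. (a, b) \<in> maximal_edges (below n f)) i j}
      = {(i, j) \<in> {0..n} \<times> {0..n}. f i = f j}"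
    using equivclp_proper_graph[OF assms] by (auto simp: maximal_edges_below[OF assms])
  then have "psi n (below n f) = {0..n} // {(i, j) \<in> {0..n} \<times> {0..n}. f i = f j}"
    by (simp add: psi_def)
  also have "\<dots> = (\<lambda>i. {(i, j) \<in> {0..n} \<times> {0..n}. f i = f j} `` {i}) ` {0..n}"
    by (auto simp: quotient_def)
  also have "\<dots> = fibres n f"
    unfolding fibres_def by (rule image_cong) auto
  finally show ?thesis .
qed

text \<open>If \<open>a < b < c < d\<close> cross, then \<open>b\<close> lies between
  \<open>a\<close> and \<open>f a\<close>, and \<open>c\<close> between \<open>b\<close> and
  \<open>f b\<close>, so nesting yields \<open>f b \<le> f a = f c \<le> f b\<close>.\<close>

lemma fibres_in_NC:
  assumes "nested n f"
  shows "fibres n f \<in> NC n"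
proof -
  have "partition_on {0..n} (fibres n f)"
    by (rule partition_onI) (auto simp: fibres_def disjnt_def)
  moreover have "noncrossing n (fibres n f)"
    unfolding noncrossing_def
  proof (intro allI impI, elim conjE)
    fix a b c d
    assume lt: "a < b" "b < c" "c < d" "d \<le> n"
      and "\<exists>B\<in>fibres n f. a \<in> B \<and> c \<in> B" "\<exists>B\<in>fibres n f. b \<in> B \<and> d \<in> B"
    then have ac: "f a = f c" and bd: "f b = f d"
      by (auto simp: fibres_def)
    note D = nestedD[OF assms]
    have "f b \<le> f a"
      using D(3)[of a b] D(1)[of c] ac lt by simp
    moreover have "f c \<le> f b"
      using D(3)[of b c] D(1)[of d] bd lt by simp
    ultimately have "f b = f a" "f c = f a" "f d = f a"
      using ac bd by auto
    then show "\<exists>B\<in>fibres n f. a \<in> B \<and> b \<in> B \<and> c \<in> B \<and> d \<in> B"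
      using lt by (intro bexI[of _ "{j \<in> {0..n}. f j = f a}"]) (auto simp: fibres_def)
  qed
  ultimately show ?thesis
    by (simp add: NC_def)
qed

section \<open>Recovering the transfer system from the fibres\<close>

lemma Max_fibre:
  assumes "nested n f" "i \<le> n"
  shows "Max {j \<in> {0..n}. f j = f i} = f i"
proof (rule Max_eqI)
  show "k \<le> f i" if "k \<in> {j \<in> {0..n}. f j = f i}" for k
    using that nestedD(1)[OF assms(1), of k] by auto
  \<comment> \<open>Idempotence puts \<open>f i\<close> in its own fibre.\<close>
  show "f i \<in> {j \<in> {0..n}. f j = f i}"
    using nestedD(2)[OF assms] nested_idem[OF assms] by simp
qed simp

lemma J_fibres:
  assumes "nested n f"
  shows "J (fibres n f) = proper_graph n f"
proof -
  have "(i, m) \<in> J (fibres n f) \<longleftrightarrow> (i, m) \<in> proper_graph n f" for i m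
  proof -
    have "(i, m) \<in> J (fibres n f) \<longleftrightarrow>
        (\<exists>k\<in>{0..n}. i \<le> n \<and> f i = f k \<and> m = Max {j \<in> {0..n}. f j = f k} \<and> m \<noteq> i)"
      by (auto simp: J_def fibres_def)
    also have "\<dots> \<longleftrightarrow> (\<exists>k\<in>{0..n}. i \<le> n \<and> f i = f k \<and> m = f k \<and> m \<noteq> i)"
      using Max_fibre[OF assms] by (intro bex_cong refl) (metis atLeastAtMost_iff)
    also have "\<dots> \<longleftrightarrow> (i, m) \<in> proper_graph n f"
      by (auto simp: proper_graph_def)
    finally show ?thesis .
  qed
  then show ?thesis
    by auto
qed

text \<open>Restricting the edge from \<open>i\<close> to \<open>f i\<close> produces every edge
  from \<open>i\<close> to a point between them; the missing loops come from reflexivity.\<close>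

lemma generated_transfer_system_proper_graph:
  assumes "nested n f"
  shows "generated_transfer_system n (proper_graph n f) = below n f"
proof
  have "proper_graph n f \<subseteq> below n f"
    using nestedD(1)[OF assms] by (auto simp: proper_graph_def below_def)
  then show "generated_transfer_system n (proper_graph n f) \<subseteq> below n f"
    unfolding generated_transfer_system_def using transfer_system_below[OF assms] by blast
  have "(i, j) \<in> R"
    if R: "transfer_system n R" "proper_graph n f \<subseteq> R" and ij: "(i, j) \<in> below n f" for R i j
  proof -
    have "(i, f i) \<in> R"
    proof (cases "f i = i")
      case True
      then show ?thesis using ij transfer_systemD(3)[OF R(1)] by (simp add: below_def)
    next
      case False
      then show ?thesis using ij R(2) by (auto simp: below_def proper_graph_def)
    qed
    then show ?thesis
      using ij transfer_systemD(5)[OF R(1)] by (auto simp: below_def)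
  qed
  then show "below n f \<subseteq> generated_transfer_system n (proper_graph n f)"
    by (auto simp: generated_transfer_system_def)
qed

lemma chi_fibres: "nested n f \<Longrightarrow> chi n (fibres n f) = below n f"
  by (simp add: chi_def J_fibres generated_transfer_system_proper_graph)

section \<open>Noncrossing partitions as fibres\<close>

lemma NC_imp_fibres:
  assumes "P \<in> NC n"
  obtains f where "nested n f" "P = fibres n f"
proof
  have part: "partition_on {0..n} P" and nc: "noncrossing n P"
    using assms by (auto simp: NC_def)
  define blk where "blk = (\<lambda>i. THE B. B \<in> P \<and> i \<in> B)"
  define f where "f = (\<lambda>i. Max (blk i))"
  have sub: "B \<subseteq> {0..n}" if "B \<in> P" for B
    using part that by (auto simp: partition_on_def)
  have uniq: "B = C" if "B \<in> P" "C \<in> P" "i \<in> B" "i \<in> C" for B C i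
    using partition_onD2[OF part] that by (auto simp: disjoint_def)
  have blkI: "blk i = B" if "B \<in> P" "i \<in> B" for i B
    unfolding blk_def by (rule the_equality) (use that uniq in auto)
  have blk: "blk i \<in> P" "i \<in> blk i" if i: "i \<le> n" for i
  proof -
    have "i \<in> \<Union>P" using partition_onD1[OF part] i by auto
    then obtain B where "B \<in> P" "i \<in> B" by blast
    then show "blk i \<in> P" "i \<in> blk i" using blkI by auto
  qed
  have fin: "finite (blk i)" if "i \<le> n" for i
    using sub[OF blk(1)[OF that]] by (rule finite_subset) simp
  have f_in: "f i \<in> blk i" if "i \<le> n" for i
    unfolding f_def using Max_in[OF fin[OF that]] blk(2)[OF that] by auto
  have f_le: "f i \<le> n" if "i \<le> n" for i
    using f_in[OF that] sub[OF blk(1)[OF that]] by auto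
  have f_ge: "j \<le> f i" if "i \<le> n" "j \<in> blk i" for i j
    unfolding f_def using Max_ge[OF fin[OF that(1)] that(2)] .
  \<comment> \<open>Blocks are disjoint and contain their maxima, so the maximum identifies the
    block.\<close>
  have same: "f i = f j \<longleftrightarrow> blk i = blk j" if "i \<le> n" "j \<le> n" for i j
    using uniq[of "blk i" "blk j" "f i"] blk(1) f_in that by (auto simp: f_def)
  show "nested n f"
    unfolding nested_def
  proof (intro allI impI conjI)
    fix i assume i: "i \<le> n"
    show "i \<le> f i" using f_ge[OF i blk(2)[OF i]] .
    show "f i \<le> n" using f_le[OF i] .
    fix j assume ij: "i \<le> j" and jf: "j \<le> f i"
    have j: "j \<le> n" using jf f_le[OF i] by simp
    have idem: "f (f i) = f i"
      using blkI[OF blk(1)[OF i] f_in[OF i]] by (simp add: f_def)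
    show "f j \<le> f i"
    proof (rule ccontr)
      assume gt: "\<not> f j \<le> f i"
      \<comment> \<open>Equality \<open>j = i\<close> or \<open>j = f i\<close> would force
        \<open>f j = f i\<close>. The strict chain is a crossing, so noncrossing merges the two
        blocks and their maxima agree, a contradiction.\<close>
      then have "i < j" "j < f i" "f i < f j"
        using ij jf idem by (auto simp: le_less)
      then have "\<exists>B\<in>P. i \<in> B \<and> j \<in> B \<and> f i \<in> B \<and> f j \<in> B"
        using nc[unfolded noncrossing_def, rule_format, of i j "f i" "f j"]
          blk[OF i] blk[OF j] f_in[OF i] f_in[OF j] f_le[OF j] by blast
      then have "blk i = blk j" using blkI by metis
      then show False using gt by (simp add: f_def)
    qed
  qed
  have fibre: "{j \<in> {0..n}. f j = f i} = blk i" if i: "i \<le> n" for i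
    using same[OF _ i] blk sub[OF blk(1)[OF i]] blkI[OF blk(1)[OF i]] by auto
  have "P = blk ` {0..n}"
  proof
    show "blk ` {0..n} \<subseteq> P" using blk(1) by auto
    show "P \<subseteq> blk ` {0..n}"
    proof
      fix B assume B: "B \<in> P"
      then obtain i where "i \<in> B" using partition_onD3[OF part] by fastforce
      then show "B \<in> blk ` {0..n}" using B blkI sub[OF B] by blast
    qed
  qed
  also have "\<dots> = fibres n f"
    unfolding fibres_def using fibre by (intro image_cong) auto
  finally show "P = fibres n f" .
qed

theorem theorem5p7:
  fixes n :: nat
  shows "(\<forall>R \<in> Tr n. psi n R \<in> NC n) \<and>
         bij_betw (psi n) (Tr n) (NC n) \<and>
         (\<forall>P \<in> NC n. chi n P \<in> Tr n \<and> psi n (chi n P) = P) \<and>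
         (\<forall>R \<in> Tr n. chi n (psi n R) = R)"
proof -
  \<comment> \<open>Each \<open>R\<close> is some \<open>below n f\<close> and each \<open>P\<close>
    some \<open>fibres n f\<close> with \<open>f\<close> nested; \<open>psi\<close> and
    \<open>chi\<close> exchange these two forms.\<close>
  have R: "psi n R \<in> NC n \<and> chi n (psi n R) = R" if "R \<in> Tr n" for R
    using that unfolding Tr_def
    by (auto elim!: transfer_system_imp_below simp: psi_below fibres_in_NC chi_fibres)
  have P: "chi n P \<in> Tr n \<and> psi n (chi n P) = P" if "P \<in> NC n" for P
    using NC_imp_fibres[OF that]
    by (metis Tr_def chi_fibres mem_Collect_eq psi_below transfer_system_below)
  have "bij_betw (psi n) (Tr n) (NC n)"
    by (rule bij_betw_byWitness[where f' = "chi n"]) (use R P in auto)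
  then show ?thesis using R P by blast
qed

end
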